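(* Let $n\ge 2$. Let $g,W,H:\mathbb{R}^n\to(0,+\infty]$ be Borel functions, and let $s\in[0,1]$ and $t=1-s$ be such that $$\forall x,y\in\mathbb{R}^n,\qquad H(sx+ty)\le s\,g(x)+t\,W(y),$$ and $\int_{\mathbb{R}^n} W^{-n}=\int_{\mathbb{R}^n} g^{-n}=1$. Then $$\int_{\mathbb{R}^n} H^{1-n}\ \ge\ s\int_{\mathbb{R}^n} g^{1-n}+t\int_{\mathbb{R}^n} W^{1-n}.$$
   Context: All integrals are with respect to Lebesgue measure. Negative powers of $+\infty$ are $0$. *)

theory Defs
  imports "HOL-Analysis.Analysis"
begin

text \<open>
  Functions into \<open>(0, +\<infinity>]\<close> are functions into \<^typ>\<open>ennreal\<close> that are pointwise positive.
  Negative integer powers are \<open>powi\<close>: since \<open>inverse \<infinity> = 0\<close> in \<^typ>\<open>ennreal\<close>, negative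
  powers of \<open>\<infinity>\<close> are \<open>0\<close>.  Products follow the convention \<open>0 * \<infinity> = 0\<close>, which matters only at
  the endpoints of the parameter interval \<open>[0, 1]\<close>.
\<close>

lemma ennreal_top_powi_neg:
  assumes "k < 0"
  shows "(top :: ennreal) powi k = 0"
  using assms by (simp add: power_int_def power_0_left)

end

theory Submission
  imports Defs
begin

text \<open>
  No transport map is needed.  For \<open>a \<ge> 0\<close> put \<open>A(a) = \<integral> (g + a)\<^sup>-\<^sup>n\<close>, \<open>B(b) = \<integral> (W + b)\<^sup>-\<^sup>n\<close>,
  \<open>C(c) = \<integral> (H + c)\<^sup>-\<^sup>n\<close>.  Since \<open>H + (s a + t b)\<close> is controlled by \<open>g + a\<close> and \<open>W + b\<close>, the
  Borell--Brascamp--Lieb inequality with exponent \<open>-1/n\<close> gives \<open>C(s a + t b) \<ge> min (A a) (B b)\<close>.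
  As \<open>A\<close> and \<open>B\<close> both have maximum \<open>1\<close>, all superlevel sets at heights in \<open>(0, 1]\<close> are nonempty, and
  the one-dimensional Brunn--Minkowski inequality for them yields \<open>\<integral> C \<ge> s \<integral> A + t \<integral> B\<close>.  Finally
  \<open>(n - 1) \<integral>\<^sub>0 (g + a)\<^sup>-\<^sup>n da = g\<^sup>1\<^sup>-\<^sup>n\<close>, the integral being over \<open>a \<ge> 0\<close>, turns this into the claim.
  The Borell--Brascamp--Lieb inequality is proved by integrating out one coordinate at a time: each
  integration turns the exponent \<open>-1/(q + 1)\<close> into \<open>-1/q\<close>.
\<close>

subsection \<open>The Brunn--Minkowski inequality on the real line\<close>

text \<open>The cut point must itself lie in \<open>A\<close>, since the Brunn-Minkowski argument
  translates by it. Cuts at integers exhaust \<open>A\<close>; if no point of \<open>A\<close> lies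
  beyond the chosen cut, \<open>A\<close> is bounded above and points of \<open>A\<close> near
  \<open>Sup A\<close> are used instead.\<close>

lemma emeasure_lborel_lower_part:
  fixes A :: "real set"
  assumes A [measurable]: "A \<in> sets borel" and "A \<noteq> {}" and e: "e < emeasure lborel A"
  obtains x where "x \<in> A" "e < emeasure lborel (A \<inter> {..x})"
proof -
  have exhaust: "\<exists>k. e < emeasure lborel (B k)"
    if "incseq B" "range B \<subseteq> sets borel" "(\<Union>k. B k) = A" for B :: "nat \<Rightarrow> real set"
  proof -
    have "(SUP k. emeasure lborel (B k)) = emeasure lborel A"
      using SUP_emeasure_incseq[of B lborel] that by simp
    with e have "e < (SUP k. emeasure lborel (B k))"
      by simp
    then show ?thesis
      by (simp add: less_SUP_iff)
  qed
  have "\<exists>k::nat. e < emeasure lborel (A \<inter> {..real k})"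
  proof (rule exhaust)
    show "(\<Union>k::nat. A \<inter> {..real k}) = A"
      by (auto simp: real_arch_simple)
    show "incseq (\<lambda>k::nat. A \<inter> {..real k})"
      by (rule incseq_SucI) auto
  qed auto
  then obtain k :: nat where k: "e < emeasure lborel (A \<inter> {..real k})"
    by blast
  show thesis
  proof (cases "\<exists>x\<in>A. real k \<le> x")
    case True
    then obtain x where "x \<in> A" "real k \<le> x"
      by blast
    then have "emeasure lborel (A \<inter> {..real k}) \<le> emeasure lborel (A \<inter> {..x})"
      by (intro emeasure_mono) auto
    with k that \<open>x \<in> A\<close> show thesis
      by force
  next
    case False
    then have bdd: "bdd_above A"
      by (intro bdd_aboveI[of _ "real k"]) auto
    have le: "x \<le> Sup A" if "x \<in> A" for x
      using bdd that by (rule cSup_upper[rotated])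
    show thesis
    proof (cases "Sup A \<in> A")
      case True
      moreover have "A \<inter> {..Sup A} = A"
        using le by auto
      ultimately show thesis
        using that e by force
    next
      case False
      \<comment> \<open>As the supremum is not attained, rays ending strictly below it still exhaust
        \<open>A\<close>, and each of these ends is exceeded by a point of \<open>A\<close>.\<close>
      have "\<exists>j::nat. e < emeasure lborel (A \<inter> {..Sup A - 1 / real (Suc j)})"
      proof (rule exhaust)
        have "\<exists>j::nat. x \<le> Sup A - 1 / real (Suc j)" if "x \<in> A" for x
        proof -
          have "x < Sup A"
            using le[OF that] that False by (metis order_le_less)
          then obtain j where "inverse (real (Suc j)) < Sup A - x"
            using reals_Archimedean[of "Sup A - x"] by auto
          then show ?thesis
            by (intro exI[of _ j]) (simp add: inverse_eq_divide)
        qed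
        then show "(\<Union>j::nat. A \<inter> {..Sup A - 1 / real (Suc j)}) = A"
          by auto
        show "incseq (\<lambda>j::nat. A \<inter> {..Sup A - 1 / real (Suc j)})"
        proof (rule incseq_SucI)
          fix j :: nat
          have "1 / real (Suc (Suc j)) \<le> 1 / real (Suc j)"
            by (intro divide_left_mono) auto
          then show "A \<inter> {..Sup A - 1 / real (Suc j)} \<subseteq> A \<inter> {..Sup A - 1 / real (Suc (Suc j))}"
            by auto
        qed
      qed auto
      then obtain j :: nat where j: "e < emeasure lborel (A \<inter> {..Sup A - 1 / real (Suc j)})"
        by blast
      obtain x where x: "x \<in> A" "Sup A - 1 / real (Suc j) < x"
        using less_cSupE[of "Sup A - 1 / real (Suc j)" A] \<open>A \<noteq> {}\<close> by auto
      then have "emeasure lborel (A \<inter> {..Sup A - 1 / real (Suc j)}) \<le> emeasure lborel (A \<inter> {..x})"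
        by (intro emeasure_mono) auto
      with j that x show thesis
        by force
    qed
  qed
qed

lemma emeasure_lborel_uminus:
  fixes A :: "real set"
  assumes "A \<in> sets borel"
  shows "emeasure lborel (uminus -` A) = emeasure lborel A"
  using assms by (subst (2) lborel_distr_uminus[symmetric]) (simp add: emeasure_distr)

text \<open>Reflection of the previous lemma. The ray is open so that, in the Brunn-Minkowski
  argument, the upper piece is disjoint from the lower one; the discarded endpoint is a null
  set.\<close>

lemma emeasure_lborel_upper_part:
  fixes A :: "real set"
  assumes A [measurable]: "A \<in> sets borel" and "A \<noteq> {}" and e: "e < emeasure lborel A"
  obtains x where "x \<in> A" "e < emeasure lborel (A \<inter> {x<..})"
proof -
  have [measurable]: "uminus -` A \<in> sets borel"
    using measurable_sets_borel[OF borel_measurable_uminus[OF measurable_ident] A] by simp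
  have "uminus -` A \<noteq> {}"
    using \<open>A \<noteq> {}\<close> by (metis all_not_in_conv minus_minus vimageI)
  moreover have "e < emeasure lborel (uminus -` A)"
    using e by (simp add: emeasure_lborel_uminus)
  ultimately obtain x where x: "x \<in> uminus -` A" "e < emeasure lborel (uminus -` A \<inter> {..x})"
    by (rule emeasure_lborel_lower_part[rotated]) auto
  have "uminus -` A \<inter> {..x} = uminus -` (A \<inter> {-x..})"
    by auto
  with x have "e < emeasure lborel (A \<inter> {-x..})"
    using emeasure_lborel_uminus[of "A \<inter> {-x..}"] by simp
  also have "emeasure lborel (A \<inter> {-x..}) = emeasure lborel (A \<inter> {-x<..} \<union> {-x})"
    using x by (intro arg_cong[where f = "emeasure lborel"]) auto
  also have "\<dots> = emeasure lborel (A \<inter> {-x<..})"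
    by (intro emeasure_Un_null_set) auto
  finally show thesis
    using that x by auto
qed

lemma emeasure_lborel_affine_vimage:
  fixes C :: "real set"
  assumes [measurable]: "C \<in> sets borel" and "0 < c"
  shows "emeasure lborel C = ennreal c * emeasure lborel {x. b + c * x \<in> C}"
proof -
  have "emeasure lborel C = (\<integral>\<^sup>+ x. indicator C x \<partial>lborel)"
    by simp
  also have "\<dots> = ennreal c * (\<integral>\<^sup>+ x. indicator C (b + c * x) \<partial>lborel)"
    using \<open>0 < c\<close> by (subst nn_integral_real_affine[where c = c and t = b]) auto
  also have "(\<integral>\<^sup>+ x. indicator C (b + c * x) \<partial>lborel) = (\<integral>\<^sup>+ x. indicator {x. b + c * x \<in> C} x \<partial>(lborel::real measure))"
    by (intro nn_integral_cong) (auto simp: indicator_def)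
  also have "\<dots> = emeasure lborel {x. b + c * x \<in> C}"
    by (intro nn_integral_indicator) simp
  finally show ?thesis .
qed

text \<open>If \<open>a\<close> lies near the top of \<open>A\<close> and \<open>b\<close> near the bottom of \<open>B\<close>, then \<open>s A + t b\<close> and
  \<open>s a + t B\<close> essentially lie on opposite sides of \<open>s a + t b\<close>.\<close>

lemma brunn_minkowski_real:
  fixes A B C :: "real set" and s t :: real
  assumes [measurable]: "A \<in> sets borel" "B \<in> sets borel" "C \<in> sets borel"
    and ne: "A \<noteq> {}" "B \<noteq> {}" and st: "0 < s" "0 < t"
    and C: "\<And>x y. x \<in> A \<Longrightarrow> y \<in> B \<Longrightarrow> s * x + t * y \<in> C"
  shows "ennreal s * emeasure lborel A + ennreal t * emeasure lborel B \<le> emeasure lborel C"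
proof -
  have part: "ennreal s * emeasure lborel (A \<inter> {..a}) + ennreal t * emeasure lborel (B \<inter> {b<..})
      \<le> emeasure lborel C" if "a \<in> A" "b \<in> B" for a b
  proof -
    define z where "z = s * a + t * b"
    have "ennreal s * emeasure lborel (A \<inter> {..a})
        \<le> ennreal s * emeasure lborel {x. t * b + s * x \<in> C \<inter> {..z}}"
      using C \<open>b \<in> B\<close> st
      by (intro mult_left_mono emeasure_mono) (auto simp: z_def add.commute)
    also have "\<dots> = emeasure lborel (C \<inter> {..z})"
      using st by (intro emeasure_lborel_affine_vimage[symmetric]) auto
    finally have 1: "ennreal s * emeasure lborel (A \<inter> {..a}) \<le> emeasure lborel (C \<inter> {..z})" .
    have "ennreal t * emeasure lborel (B \<inter> {b<..})
        \<le> ennreal t * emeasure lborel {x. s * a + t * x \<in> C \<inter> {z<..}}"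
      using C \<open>a \<in> A\<close> st
      by (intro mult_left_mono emeasure_mono) (auto simp: z_def add.commute)
    also have "\<dots> = emeasure lborel (C \<inter> {z<..})"
      using st by (intro emeasure_lborel_affine_vimage[symmetric]) auto
    finally have "ennreal s * emeasure lborel (A \<inter> {..a}) + ennreal t * emeasure lborel (B \<inter> {b<..})
        \<le> emeasure lborel (C \<inter> {..z}) + emeasure lborel (C \<inter> {z<..})"
      using 1 by (rule add_mono[rotated])
    also have "\<dots> = emeasure lborel (C \<inter> {..z} \<union> C \<inter> {z<..})"
      by (intro plus_emeasure) auto
    also have "\<dots> \<le> emeasure lborel C"
      by (intro emeasure_mono) auto
    finally show ?thesis .
  qed
  \<comment> \<open>The measures are written as suprema over cut points in the sets, so that
    \<open>part\<close>, which holds for each pair of cut points, passes to the limit.\<close>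
  have SA: "emeasure lborel A = (SUP a\<in>A. emeasure lborel (A \<inter> {..a}))"
  proof (rule antisym)
    show "emeasure lborel A \<le> (SUP a\<in>A. emeasure lborel (A \<inter> {..a}))"
    proof (rule dense_le)
      fix e assume "e < emeasure lborel A"
      then obtain a where "a \<in> A" "e < emeasure lborel (A \<inter> {..a})"
        using emeasure_lborel_lower_part[OF assms(1) ne(1)] by metis
      then show "e \<le> (SUP a\<in>A. emeasure lborel (A \<inter> {..a}))"
        by (meson SUP_upper2 less_imp_le)
    qed
  qed (auto intro!: SUP_least emeasure_mono)
  have SB: "emeasure lborel B = (SUP b\<in>B. emeasure lborel (B \<inter> {b<..}))"
  proof (rule antisym)
    show "emeasure lborel B \<le> (SUP b\<in>B. emeasure lborel (B \<inter> {b<..}))"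
    proof (rule dense_le)
      fix e assume "e < emeasure lborel B"
      then obtain b where "b \<in> B" "e < emeasure lborel (B \<inter> {b<..})"
        using emeasure_lborel_upper_part[OF assms(2) ne(2)] by metis
      then show "e \<le> (SUP b\<in>B. emeasure lborel (B \<inter> {b<..}))"
        by (meson SUP_upper2 less_imp_le)
    qed
  qed (auto intro!: SUP_least emeasure_mono)
  have "ennreal s * emeasure lborel A + ennreal t * emeasure lborel B
      = (SUP b\<in>B. SUP a\<in>A. ennreal s * emeasure lborel (A \<inter> {..a}) + ennreal t * emeasure lborel (B \<inter> {b<..}))"
    unfolding SA SB SUP_mult_left_ennreal
    \<comment> \<open>A constant summand moves through a supremum only when the index set is
      nonempty.\<close>
    using ne by (simp add: ennreal_SUP_add_left ennreal_SUP_add_right)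
  also have "\<dots> \<le> emeasure lborel C"
    by (intro SUP_least part)
  finally show ?thesis .
qed

section \<open>Layer cake formula and comparison of superlevel sets\<close>

text \<open>Tonelli applied to the region under the graph; truncation at 1 restricts the levels to
  \<open>{0<..1}\<close>.\<close>

lemma nn_integral_min_1_layer_cake:
  fixes F :: "real \<Rightarrow> ennreal"
  assumes [measurable]: "F \<in> borel_measurable borel"
  shows "(\<integral>\<^sup>+ x. min (F x) 1 \<partial>lborel)
    = (\<integral>\<^sup>+ l. emeasure lborel {x. ennreal l \<le> F x} * indicator {0<..1} l \<partial>lborel)"
proof -
  have "(\<integral>\<^sup>+ l. emeasure lborel {x. ennreal l \<le> F x} * indicator {0<..1} l \<partial>lborel)
      = (\<integral>\<^sup>+ l. \<integral>\<^sup>+ x. indicator {x. ennreal l \<le> F x} x * indicator {0<..1} l \<partial>lborel \<partial>lborel)"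
    by (intro nn_integral_cong) (simp add: nn_integral_multc)
  also have "\<dots> = (\<integral>\<^sup>+ x. \<integral>\<^sup>+ l. indicator {x. ennreal l \<le> F x} x * indicator {0<..1} l \<partial>lborel \<partial>lborel)"
    by (intro lborel_pair.Fubini') measurable
  also have "\<dots> = (\<integral>\<^sup>+ x. emeasure lborel {0 <.. enn2real (min (F x) 1)} \<partial>lborel)"
  proof (intro nn_integral_cong)
    fix x
    have "ennreal l \<le> F x \<longleftrightarrow> l \<le> enn2real (min (F x) 1)" if "0 < l" "l \<le> 1" for l
      using that by (cases "F x") (auto simp: min_def top_unique)
    moreover have "enn2real (min (F x) 1) \<le> 1"
      by (intro enn2real_leI) auto
    ultimately have "indicator {x. ennreal l \<le> F x} x * indicator {0<..1} l
        = (indicator {0 <.. enn2real (min (F x) 1)} l :: ennreal)" for l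
      by (auto simp: indicator_def)
    then show "(\<integral>\<^sup>+ l. indicator {x. ennreal l \<le> F x} x * indicator {0<..1} l \<partial>lborel)
        = emeasure lborel {0 <.. enn2real (min (F x) 1)}"
      by simp
  qed
  also have "\<dots> = (\<integral>\<^sup>+ x. min (F x) 1 \<partial>lborel)"
  proof (intro nn_integral_cong)
    fix x
    have "min (F x) 1 < top"
      by (simp add: min_less_iff_disj)
    then show "emeasure lborel {0 <.. enn2real (min (F x) 1)} = min (F x) 1"
      by simp
  qed
  finally show ?thesis by simp
qed

text \<open>The points \<open>x1\<close> and \<open>y1\<close> make all superlevel sets of
  \<open>F\<close> and \<open>G\<close> at levels up to 1 nonempty, so one-dimensional
  Brunn-Minkowski applies at each such level. Integrating over the levels gives a bound by the
  arithmetic mean of the truncated integrals.\<close>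

lemma nn_integral_ge_of_level_sets:
  fixes F G K :: "real \<Rightarrow> ennreal" and s t :: real
  assumes [measurable]: "F \<in> borel_measurable borel" "G \<in> borel_measurable borel" "K \<in> borel_measurable borel"
    and st: "0 < s" "0 < t"
    and F1: "1 \<le> F x1" and G1: "1 \<le> G y1"
    and K: "\<And>l x y. 0 < l \<Longrightarrow> l \<le> 1 \<Longrightarrow> ennreal l \<le> F x \<Longrightarrow> ennreal l \<le> G y \<Longrightarrow> ennreal l \<le> K (s * x + t * y)"
  shows "ennreal s * (\<integral>\<^sup>+ x. min (F x) 1 \<partial>lborel) + ennreal t * (\<integral>\<^sup>+ x. min (G x) 1 \<partial>lborel) \<le> (\<integral>\<^sup>+ x. K x \<partial>lborel)"
proof -
  have level: "ennreal s * emeasure lborel {x. ennreal l \<le> F x} + ennreal t * emeasure lborel {x. ennreal l \<le> G x}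
      \<le> emeasure lborel {x. ennreal l \<le> K x}" if "0 < l" "l \<le> 1" for l
  proof (rule brunn_minkowski_real)
    have "ennreal l \<le> 1"
      using that by simp
    then have "ennreal l \<le> F x1" "ennreal l \<le> G y1"
      using F1 G1 by (blast intro: order_trans)+
    then show "{x. ennreal l \<le> F x} \<noteq> {}" "{x. ennreal l \<le> G x} \<noteq> {}"
      by auto
  qed (use st K that in auto)
  have "ennreal s * (\<integral>\<^sup>+ x. min (F x) 1 \<partial>lborel) + ennreal t * (\<integral>\<^sup>+ x. min (G x) 1 \<partial>lborel)
    = (\<integral>\<^sup>+ l. (ennreal s * emeasure lborel {x. ennreal l \<le> F x}
        + ennreal t * emeasure lborel {x. ennreal l \<le> G x}) * indicator {0<..1} l \<partial>lborel)"
    unfolding nn_integral_min_1_layer_cake[OF assms(1)] nn_integral_min_1_layer_cake[OF assms(2)]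
    by (simp add: nn_integral_add nn_integral_cmult distrib_right mult.assoc)
  also have "\<dots> \<le> (\<integral>\<^sup>+ l. emeasure lborel {x. ennreal l \<le> K x} * indicator {0<..1} l \<partial>lborel)"
    by (intro nn_integral_mono) (auto simp: indicator_def intro: level)
  also have "\<dots> = (\<integral>\<^sup>+ x. min (K x) 1 \<partial>lborel)"
    by (simp add: nn_integral_min_1_layer_cake)
  also have "\<dots> \<le> (\<integral>\<^sup>+ x. K x \<partial>lborel)"
    by (intro nn_integral_mono) simp
  finally show ?thesis .
qed

subsection \<open>The Borell--Brascamp--Lieb inequality\<close>

text \<open>For positive real \<open>u\<close>, \<open>v\<close> and \<open>q > 0\<close> this says \<open>w \<ge> (s u powr (-1/q) + t v powr (-1/q)) powr (-q)\<close>;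
  for \<open>q = 0\<close> it degenerates to the normalised minimum: \<open>u \<ge> 1\<close> and \<open>v \<ge> 1\<close> imply \<open>w \<ge> 1\<close>.
  Quantifying over \<open>a\<close> and \<open>b\<close> avoids real powers of extended reals.\<close>

definition dominates_power_mean ::
    "nat \<Rightarrow> real \<Rightarrow> real \<Rightarrow> ennreal \<Rightarrow> ennreal \<Rightarrow> ennreal \<Rightarrow> bool" where
  "dominates_power_mean q s t u v w \<longleftrightarrow>
    (\<forall>a b. 0 < a \<longrightarrow> 0 < b \<longrightarrow> ennreal (1 / a ^ q) \<le> u \<longrightarrow> ennreal (1 / b ^ q) \<le> v
      \<longrightarrow> ennreal (1 / (s * a + t * b) ^ q) \<le> w)"

lemma dominates_power_meanI:
  assumes "\<And>a b. 0 < a \<Longrightarrow> 0 < b \<Longrightarrow> ennreal (1 / a ^ q) \<le> u \<Longrightarrow> ennreal (1 / b ^ q) \<le> v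
    \<Longrightarrow> ennreal (1 / (s * a + t * b) ^ q) \<le> w"
  shows "dominates_power_mean q s t u v w"
  using assms by (simp add: dominates_power_mean_def)

lemma dominates_power_meanD:
  assumes "dominates_power_mean q s t u v w" "0 < a" "0 < b"
    "ennreal (1 / a ^ q) \<le> u" "ennreal (1 / b ^ q) \<le> v"
  shows "ennreal (1 / (s * a + t * b) ^ q) \<le> w"
  using assms by (simp add: dominates_power_mean_def)

section \<open>Scaling and truncation of extended nonnegative functions\<close>

lemma ennreal_le_mult_iff:
  assumes "0 < c" "0 \<le> l"
  shows "ennreal l \<le> ennreal c * u \<longleftrightarrow> ennreal (l / c) \<le> u"
proof (cases u)
  case (real r)
  with assms show ?thesis
    by (simp add: ennreal_mult[symmetric] divide_le_eq mult.commute)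
next
  case top
  with assms show ?thesis
    by (simp add: ennreal_mult_top)
qed

lemma min_mult_ennreal_1:
  assumes "0 < c"
  shows "min (ennreal c * u) 1 = ennreal c * min u (ennreal (1 / c))"
proof (cases u)
  case (real r)
  with assms show ?thesis
    by (auto simp: min_def ennreal_mult[symmetric] ennreal_1[symmetric] field_simps
        simp del: ennreal_1)
next
  case top
  with assms show ?thesis
    by (simp add: ennreal_mult_top ennreal_mult[symmetric])
qed

lemma exists_factor_less_ennreal:
  fixes e I :: ennreal
  assumes "e < I"
  obtains r where "0 < r" "r < 1" "e < ennreal r * I"
proof (cases I)
  case (real i)
  with assms obtain d where d: "e = ennreal d" "0 \<le> d" "d < i"
    by (cases e) (auto simp: ennreal_less_iff)
  \<comment> \<open>The midpoint between \<open>d / i\<close>, which is below 1, and 1.\<close>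
  define r where "r = (d / i + 1) / 2"
  have "0 < r" "r < 1" "d < r * i"
    using d by (auto simp: r_def field_simps)
  with d real that show thesis
    by (simp add: ennreal_mult[symmetric] ennreal_less_iff)
next
  case top
  with assms that[of "1/2"] show thesis
    by (simp add: ennreal_mult_top)
qed

text \<open>A truncation height that \<open>f\<close> reaches keeps the superlevel sets up to that
  height nonempty. Either a large integer height is reached, or \<open>f\<close> is bounded and a
  height slightly below its supremum serves.\<close>

lemma nn_integral_attained_truncation:
  fixes f :: "'a \<Rightarrow> ennreal"
  assumes f [measurable]: "f \<in> borel_measurable M" and e: "e < (\<integral>\<^sup>+ x. f x \<partial>M)"
  obtains c x where "0 < c" "ennreal c \<le> f x" "e < (\<integral>\<^sup>+ x. min (f x) (ennreal c) \<partial>M)"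
proof -
  have "(\<integral>\<^sup>+ x. f x \<partial>M) = (\<integral>\<^sup>+ x. (SUP k. min (f x) (of_nat k)) \<partial>M)"
  proof (intro nn_integral_cong)
    fix x
    show "f x = (SUP k. min (f x) (of_nat k))"
      using ennreal_SUP_of_nat_eq_top
      by (metis inf_SUP inf_min inf_top.right_neutral)
  qed
  also have "\<dots> = (SUP k. \<integral>\<^sup>+ x. min (f x) (of_nat k) \<partial>M)"
    by (intro nn_integral_monotone_convergence_SUP incseq_SucI le_funI) (auto simp: min_le_iff_disj intro: min.mono order_trans)
  finally obtain k where k: "e < (\<integral>\<^sup>+ x. min (f x) (of_nat k) \<partial>M)"
    using e by (auto simp: less_SUP_iff)
  then have "k \<noteq> 0"
    by (intro notI) simp
  show thesis
  proof (cases "\<exists>x. of_nat k \<le> f x")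
    case True
    with k \<open>k \<noteq> 0\<close> that[of "real k"] show thesis
      by (auto simp: ennreal_of_nat_eq_real_of_nat)
  next
    case False
    define S where "S = (SUP x. f x)"
    have "f x \<le> of_nat k" for x
      using False by (meson less_imp_le not_le)
    then have "S \<le> of_nat k"
      unfolding S_def by (rule SUP_least)
    then obtain r where r: "S = ennreal r" "0 \<le> r"
      by (cases S) (auto simp: top_unique)
    have f_le: "f x \<le> ennreal r" for x
      unfolding r(1)[symmetric] S_def by (rule SUP_upper) simp
    have "r \<noteq> 0"
    proof
      assume "r = 0"
      then have "f = (\<lambda>_. 0)"
        using f_le by auto
      with e show False
        by simp
    qed
    with r have "0 < r" by simp
    obtain d where d: "0 < d" "d < 1" "e < ennreal d * (\<integral>\<^sup>+ x. f x \<partial>M)"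
      using exists_factor_less_ennreal[OF e] .
    have "ennreal (d * r) < (SUP x. f x)"
      unfolding S_def[symmetric] r(1) using d \<open>0 < r\<close> by (simp add: ennreal_less_iff)
    then obtain x where x: "ennreal (d * r) < f x"
      by (auto simp: less_SUP_iff)
    have "e < (\<integral>\<^sup>+ x. ennreal d * f x \<partial>M)"
      using d by (simp add: nn_integral_cmult)
    \<comment> \<open>Since \<open>f\<close> is bounded by \<open>r\<close>, truncation at
      \<open>d * r\<close> loses at most the factor \<open>d\<close>.\<close>
    also have "\<dots> \<le> (\<integral>\<^sup>+ x. min (f x) (ennreal (d * r)) \<partial>M)"
    proof (intro nn_integral_mono min.boundedI)
      fix x
      have "ennreal d * f x \<le> 1 * f x"
        using d by (intro mult_right_mono) auto
      then show "ennreal d * f x \<le> f x"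
        by simp
      show "ennreal d * f x \<le> ennreal (d * r)"
        using d \<open>0 < r\<close> f_le[of x] by (auto simp: ennreal_mult intro: mult_left_mono)
    qed
    finally show thesis
      using that[of "d * r" x] x d \<open>0 < r\<close> by auto
  qed
qed

text \<open>Jensen's inequality for \<open>z ^ Suc q\<close> at the points \<open>x / a\<close> and \<open>y / b\<close>, with weights proportional
  to \<open>s a\<close> and \<open>t b\<close>.\<close>

lemma power_Suc_weighted_le:
  fixes a b s t x y :: real
  assumes "0 < a" "0 < b" "0 < s" "0 < t" "0 < x" "0 < y"
  shows "(s * x + t * y) ^ Suc q \<le> (s * a + t * b) ^ q * (s * x ^ Suc q / a ^ q + t * y ^ Suc q / b ^ q)"
proof -
  define D where "D = s * a + t * b"
  define v where "v = t * b / D"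
  have "0 < D"
    using assms by (simp add: D_def add_pos_pos)
  have v: "0 \<le> v" "v \<le> 1" "1 - v = s * a / D"
    using assms \<open>0 < D\<close> by (auto simp: v_def field_simps D_def)
  have "convex_on {0..} (\<lambda>x::real. x ^ Suc q)"
  proof (cases "even (Suc q)")
    case True
    then show ?thesis
      using convex_power_even convex_on_subset by blast
  qed (rule convex_power_odd)
  then have "((1 - v) * (x / a) + v * (y / b)) ^ Suc q \<le> (1 - v) * (x / a) ^ Suc q + v * (y / b) ^ Suc q"
    using convex_onD[of "{0..}" "\<lambda>x::real. x ^ Suc q" v "x / a" "y / b"] v assms by simp
  moreover have "(1 - v) * (x / a) + v * (y / b) = (s * x + t * y) / D"
    using assms unfolding v by (simp add: v_def add_divide_distrib)
  moreover have "(1 - v) * (x / a) ^ Suc q + v * (y / b) ^ Suc q = (s * x ^ Suc q / a ^ q + t * y ^ Suc q / b ^ q) / D"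
    using assms unfolding v by (simp add: v_def add_divide_distrib power_divide ac_simps)
  ultimately have "((s * x + t * y) / D) ^ Suc q \<le> (s * x ^ Suc q / a ^ q + t * y ^ Suc q / b ^ q) / D"
    by simp
  then have "((s * x + t * y) / D) ^ Suc q * D ^ Suc q \<le> (s * x ^ Suc q / a ^ q + t * y ^ Suc q / b ^ q) / D * D ^ Suc q"
    using \<open>0 < D\<close> by (intro mult_right_mono) auto
  then have "(s * x + t * y) ^ Suc q \<le> (s * x ^ Suc q / a ^ q + t * y ^ Suc q / b ^ q) * D ^ q"
    using \<open>0 < D\<close> by (simp add: power_divide)
  then show ?thesis
    by (simp add: D_def mult.commute)
qed

text \<open>Multiplying \<open>f\<close> by \<open>a ^ p\<close> and \<open>g\<close> by \<open>b ^ p\<close> puts both truncations at height \<open>1\<close>, so that the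
  superlevel sets of \<open>f\<close> and \<open>g\<close> at a common height below \<open>1\<close> are nonempty together.\<close>

lemma nn_integral_truncations_le:
  fixes f g h :: "real \<Rightarrow> ennreal" and s t :: real
  assumes [measurable]: "f \<in> borel_measurable borel" "g \<in> borel_measurable borel" "h \<in> borel_measurable borel"
    and st: "0 < s" "0 < t" and "p \<noteq> 0"
    and mean: "\<And>x y. dominates_power_mean p s t (f x) (g y) (h (s * x + t * y))"
    and m: "0 < a" "0 < b" and f: "ennreal (1 / a ^ p) \<le> f x1" and g: "ennreal (1 / b ^ p) \<le> g y1"
  shows "ennreal (s * a ^ p) * (\<integral>\<^sup>+ x. min (f x) (ennreal (1 / a ^ p)) \<partial>lborel)
      + ennreal (t * b ^ p) * (\<integral>\<^sup>+ x. min (g x) (ennreal (1 / b ^ p)) \<partial>lborel)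
    \<le> ennreal ((s * a + t * b) ^ p) * (\<integral>\<^sup>+ x. h x \<partial>lborel)"
proof -
  have D: "0 < s * a + t * b"
    using st m by (simp add: add_pos_pos)
  have "ennreal s * (\<integral>\<^sup>+ x. min (ennreal (a ^ p) * f x) 1 \<partial>lborel)
      + ennreal t * (\<integral>\<^sup>+ x. min (ennreal (b ^ p) * g x) 1 \<partial>lborel)
    \<le> (\<integral>\<^sup>+ x. ennreal ((s * a + t * b) ^ p) * h x \<partial>lborel)"
  proof (rule nn_integral_ge_of_level_sets)
    show "1 \<le> ennreal (a ^ p) * f x1" "1 \<le> ennreal (b ^ p) * g y1"
      using f g m ennreal_le_mult_iff[of _ 1] by (simp_all del: ennreal_1 add: ennreal_1[symmetric] ennreal_le_mult_iff)
  next
    fix l x y :: real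
    assume l: "0 < l" and fg: "ennreal l \<le> ennreal (a ^ p) * f x" "ennreal l \<le> ennreal (b ^ p) * g y"
    \<comment> \<open>Homogeneity: replacing \<open>a\<close>, \<open>b\<close> by
      \<open>a / k\<close>, \<open>b / k\<close> multiplies all three thresholds
      \<open>1 / a ^ p\<close>, \<open>1 / b ^ p\<close> and \<open>1 / (s * a + t * b) ^ p\<close>
      by the level \<open>l\<close>.\<close>
    define k where "k = root p l"
    have k: "0 < k" "l = k ^ p"
      using l \<open>p \<noteq> 0\<close> by (auto simp: k_def)
    have "ennreal (1 / (s * (a / k) + t * (b / k)) ^ p) \<le> h (s * x + t * y)"
    proof (rule dominates_power_meanD[OF mean])
      show "ennreal (1 / (a / k) ^ p) \<le> f x" "ennreal (1 / (b / k) ^ p) \<le> g y"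
        using fg m k by (auto simp: ennreal_le_mult_iff power_divide)
    qed (use m k in auto)
    also have "s * (a / k) + t * (b / k) = (s * a + t * b) / k"
      by (simp add: add_divide_distrib)
    finally show "ennreal l \<le> ennreal ((s * a + t * b) ^ p) * h (s * x + t * y)"
      using k D by (auto simp: ennreal_le_mult_iff power_divide)
  qed (use st in auto)
  then show ?thesis
    using st m by (simp add: min_mult_ennreal_1 nn_integral_cmult ennreal_mult mult.assoc)
qed

text \<open>Integrating out one real variable lowers the parameter by one. Both functions are
  truncated at attained heights, written as \<open>1 / m ^ Suc q\<close> and
  \<open>1 / n ^ Suc q\<close>; the bound for truncations is then combined with the weighted power
  inequality.\<close>

lemma dominates_power_mean_nn_integral:
  fixes f g h :: "real \<Rightarrow> ennreal" and s t :: real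
  assumes [measurable]: "f \<in> borel_measurable borel" "g \<in> borel_measurable borel" "h \<in> borel_measurable borel"
    and st: "0 < s" "0 < t"
    and mean: "\<And>x y. dominates_power_mean (Suc q) s t (f x) (g y) (h (s * x + t * y))"
  shows "dominates_power_mean q s t (\<integral>\<^sup>+ x. f x \<partial>lborel) (\<integral>\<^sup>+ x. g x \<partial>lborel) (\<integral>\<^sup>+ x. h x \<partial>lborel)"
proof (rule dominates_power_meanI, rule dense_le)
  fix a b e
  assume a: "0 < a" and b: "0 < b" and f: "ennreal (1 / a ^ q) \<le> (\<integral>\<^sup>+ x. f x \<partial>lborel)"
    and g: "ennreal (1 / b ^ q) \<le> (\<integral>\<^sup>+ x. g x \<partial>lborel)" and e: "e < ennreal (1 / (s * a + t * b) ^ q)"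
  define D where "D = s * a + t * b"
  have "0 < D"
    using st a b by (simp add: add_pos_pos D_def)
  obtain d where d: "e = ennreal d" "0 \<le> d" "d < 1 / D ^ q"
    using e by (cases e) (auto simp: ennreal_less_iff D_def)
  \<comment> \<open>The relative slack: as \<open>r < 1\<close>, the value \<open>r / c ^ q\<close>
    lies strictly below \<open>1 / c ^ q\<close>, which leaves room for the loss in
    truncating.\<close>
  define r where "r = d * D ^ q"
  have r: "0 \<le> r" "r < 1" "d = r / D ^ q"
    using d \<open>0 < D\<close> by (auto simp: r_def field_simps)
  have scale: "\<exists>m>0. \<exists>x. ennreal (1 / m ^ Suc q) \<le> u x
      \<and> ennreal (r / c ^ q) \<le> (\<integral>\<^sup>+ x. min (u x) (ennreal (1 / m ^ Suc q)) \<partial>lborel)"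
    if [measurable]: "u \<in> borel_measurable borel" and "0 < c" "ennreal (1 / c ^ q) \<le> (\<integral>\<^sup>+ x. u x \<partial>lborel)"
    for u :: "real \<Rightarrow> ennreal" and c :: real
  proof -
    have "ennreal (r / c ^ q) < ennreal (1 / c ^ q)"
      using r \<open>0 < c\<close> by (simp add: ennreal_less_iff divide_strict_right_mono)
    with that have less: "ennreal (r / c ^ q) < (\<integral>\<^sup>+ x. u x \<partial>lborel)"
      by simp
    have "u \<in> borel_measurable lborel"
      by simp
    with less obtain k x where k: "0 < k" "ennreal k \<le> u x"
        "ennreal (r / c ^ q) < (\<integral>\<^sup>+ x. min (u x) (ennreal k) \<partial>lborel)"
      using nn_integral_attained_truncation by metis
    moreover have "k = 1 / (1 / root (Suc q) k) ^ Suc q"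
      using \<open>0 < k\<close> by (simp only: power_divide real_root_pow_pos) simp
    ultimately show ?thesis
      by (intro exI[of _ "1 / root (Suc q) k"] conjI exI[of _ x]) auto
  qed
  obtain m x where m: "0 < m" "ennreal (1 / m ^ Suc q) \<le> f x"
      "ennreal (r / a ^ q) \<le> (\<integral>\<^sup>+ x. min (f x) (ennreal (1 / m ^ Suc q)) \<partial>lborel)"
    using scale[OF _ a f] by auto
  obtain n y where n: "0 < n" "ennreal (1 / n ^ Suc q) \<le> g y"
      "ennreal (r / b ^ q) \<le> (\<integral>\<^sup>+ x. min (g x) (ennreal (1 / n ^ Suc q)) \<partial>lborel)"
    using scale[OF _ b g] by auto
  define M where "M = s * m + t * n"
  have "0 < M"
    using st m n by (simp add: add_pos_pos M_def)
  \<comment> \<open>The weighted power inequality is taken at \<open>m\<close> and \<open>n\<close>;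
    as \<open>d = r / D ^ q\<close>, the factor \<open>D ^ q\<close> then cancels.\<close>
  have "M ^ Suc q * d \<le> D ^ q * (s * m ^ Suc q / a ^ q + t * n ^ Suc q / b ^ q) * d"
    using d power_Suc_weighted_le[OF a b st m(1) n(1)] by (intro mult_right_mono) (simp_all add: D_def M_def)
  also have "\<dots> = s * m ^ Suc q * (r / a ^ q) + t * n ^ Suc q * (r / b ^ q)"
    using \<open>0 < D\<close> by (simp add: r(3) algebra_simps)
  finally have "ennreal (M ^ Suc q * d) \<le> ennreal (s * m ^ Suc q * (r / a ^ q) + t * n ^ Suc q * (r / b ^ q))"
    by (rule ennreal_leI)
  also have "\<dots> = ennreal (s * m ^ Suc q) * ennreal (r / a ^ q) + ennreal (t * n ^ Suc q) * ennreal (r / b ^ q)"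
    using st m n a b r
    by (simp add: ennreal_mult[symmetric] ennreal_plus[symmetric] del: ennreal_plus power_Suc)
  also have "\<dots> \<le> ennreal (s * m ^ Suc q) * (\<integral>\<^sup>+ x. min (f x) (ennreal (1 / m ^ Suc q)) \<partial>lborel)
      + ennreal (t * n ^ Suc q) * (\<integral>\<^sup>+ x. min (g x) (ennreal (1 / n ^ Suc q)) \<partial>lborel)"
    using m n by (intro add_mono mult_left_mono) auto
  also have "\<dots> \<le> ennreal (M ^ Suc q) * (\<integral>\<^sup>+ x. h x \<partial>lborel)"
    unfolding M_def
    by (rule nn_integral_truncations_le[where ?x1.0 = x and ?y1.0 = y, OF _ _ _ st])
       (use mean m n in simp_all)
  finally show "e \<le> (\<integral>\<^sup>+ x. h x \<partial>lborel)"
    using \<open>0 < M\<close> d by (subst (asm) ennreal_le_mult_iff) auto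
qed

section \<open>Induction over the coordinates\<close>

text \<open>The one-variable step turns parameter \<open>Suc (card I)\<close> into
  \<open>card I\<close> on the fibres over the new coordinate; the induction hypothesis then applies
  to the fibre integrals. The restricted lambda keeps the combined point in the extensional product
  space.\<close>

lemma dominates_power_mean_nn_integral_PiM:
  fixes f g h :: "('i \<Rightarrow> real) \<Rightarrow> ennreal" and s t :: real
  assumes st: "0 < s" "0 < t" and "finite I"
    and "f \<in> borel_measurable (PiM I (\<lambda>_. lborel))" "g \<in> borel_measurable (PiM I (\<lambda>_. lborel))"
      "h \<in> borel_measurable (PiM I (\<lambda>_. lborel))"
    and "\<And>x y. x \<in> space (PiM I (\<lambda>_. lborel)) \<Longrightarrow> y \<in> space (PiM I (\<lambda>_. lborel))
      \<Longrightarrow> dominates_power_mean (card I) s t (f x) (g y) (h (\<lambda>i\<in>I. s * x i + t * y i))"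
  shows "dominates_power_mean 0 s t (\<integral>\<^sup>+ x. f x \<partial>PiM I (\<lambda>_. lborel)) (\<integral>\<^sup>+ x. g x \<partial>PiM I (\<lambda>_. lborel))
    (\<integral>\<^sup>+ x. h x \<partial>PiM I (\<lambda>_. lborel))"
  using assms(3-)
proof (induction I arbitrary: f g h rule: finite_induct)
  case empty
  then show ?case
    by (simp add: PiM_empty nn_integral_count_space_finite restrict_def)
next
  case (insert i I)
  interpret product_sigma_finite "\<lambda>_::'i. lborel :: real measure" ..
  let ?P = "\<lambda>I. PiM I (\<lambda>_::'i. lborel :: real measure)"
  have slice: "(\<lambda>u. k (x(i := u))) \<in> borel_measurable borel"
    if k: "k \<in> borel_measurable (?P (insert i I))" and x: "x \<in> space (?P I)" for k :: "_ \<Rightarrow> ennreal" and x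
    using measurable_compose[OF measurable_component_update[OF x insert.hyps(2)] k] by simp
  have fiber: "(\<lambda>x. \<integral>\<^sup>+ u. k (x(i := u)) \<partial>lborel) \<in> borel_measurable (?P I)"
    if [measurable]: "k \<in> borel_measurable (?P (insert i I))" for k :: "_ \<Rightarrow> ennreal"
    by measurable
  have "dominates_power_mean 0 s t (\<integral>\<^sup>+ x. \<integral>\<^sup>+ u. f (x(i := u)) \<partial>lborel \<partial>?P I)
      (\<integral>\<^sup>+ x. \<integral>\<^sup>+ u. g (x(i := u)) \<partial>lborel \<partial>?P I) (\<integral>\<^sup>+ x. \<integral>\<^sup>+ u. h (x(i := u)) \<partial>lborel \<partial>?P I)"
  proof (rule insert.IH)
    fix x y assume xy: "x \<in> space (?P I)" "y \<in> space (?P I)"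
    define z where "z = (\<lambda>i\<in>I. s * x i + t * y i)"
    have z: "z \<in> space (?P I)"
      by (simp add: z_def space_PiM)
    show "dominates_power_mean (card I) s t (\<integral>\<^sup>+ u. f (x(i := u)) \<partial>lborel)
      (\<integral>\<^sup>+ u. g (y(i := u)) \<partial>lborel) (\<integral>\<^sup>+ u. h (z(i := u)) \<partial>lborel)"
    proof (rule dominates_power_mean_nn_integral[OF _ _ _ st])
      fix u v
      have *: "(\<lambda>j\<in>insert i I. s * (x(i := u)) j + t * (y(i := v)) j) = z(i := s * u + t * v)"
        using insert.hyps by (auto simp: z_def fun_eq_iff)
      have "x(i := u) \<in> space (?P (insert i I))" "y(i := v) \<in> space (?P (insert i I))"
        using xy by (auto simp: space_PiM PiE_iff extensional_def)
      then have "dominates_power_mean (card (insert i I)) s t (f (x(i := u))) (g (y(i := v)))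
          (h (\<lambda>j\<in>insert i I. s * (x(i := u)) j + t * (y(i := v)) j))"
        by (rule insert.prems(4))
      then show "dominates_power_mean (Suc (card I)) s t (f (x(i := u))) (g (y(i := v))) (h (z(i := s * u + t * v)))"
        using insert.hyps unfolding * by (simp only: card_insert_disjoint not_False_eq_True)
    qed (use slice insert.prems xy z in auto)
  qed (rule fiber[OF insert.prems(1)] fiber[OF insert.prems(2)] fiber[OF insert.prems(3)])+
  then show ?case
    using insert.prems insert.hyps by (simp add: product_nn_integral_insert)
qed

text \<open>Lebesgue measure is the image of the product measure under the linear map from
  coordinates to vectors, so the product version transfers.\<close>

lemma borell_brascamp_lieb:
  fixes f g h :: "'a::euclidean_space \<Rightarrow> ennreal" and s t :: real
  assumes st: "0 < s" "0 < t"
    and [measurable]: "f \<in> borel_measurable borel" "g \<in> borel_measurable borel" "h \<in> borel_measurable borel"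
    and mean: "\<And>x y. dominates_power_mean DIM('a) s t (f x) (g y) (h (s *\<^sub>R x + t *\<^sub>R y))"
    and f: "1 \<le> (\<integral>\<^sup>+ x. f x \<partial>lborel)" and g: "1 \<le> (\<integral>\<^sup>+ x. g x \<partial>lborel)"
  shows "1 \<le> (\<integral>\<^sup>+ x. h x \<partial>lborel)"
proof -
  let ?P = "PiM (Basis :: 'a set) (\<lambda>_. lborel :: real measure)"
  let ?v = "\<lambda>x. \<Sum>b\<in>Basis. x b *\<^sub>R (b :: 'a)"
  have eq: "(\<integral>\<^sup>+ x. k x \<partial>lborel) = (\<integral>\<^sup>+ x. k (?v x) \<partial>?P)"
    if [measurable]: "k \<in> borel_measurable borel" for k :: "'a \<Rightarrow> ennreal"
    by (subst lborel_eq, subst nn_integral_distr) auto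
  have "dominates_power_mean 0 s t (\<integral>\<^sup>+ x. f (?v x) \<partial>?P) (\<integral>\<^sup>+ x. g (?v x) \<partial>?P) (\<integral>\<^sup>+ x. h (?v x) \<partial>?P)"
  proof (rule dominates_power_mean_nn_integral_PiM[OF st])
    fix x y :: "'a \<Rightarrow> real"
    have "?v (\<lambda>b\<in>Basis. s * x b + t * y b) = s *\<^sub>R ?v x + t *\<^sub>R ?v y"
      by (simp add: scaleR_sum_right sum.distrib scaleR_add_left)
    then show "dominates_power_mean DIM('a) s t (f (?v x)) (g (?v y)) (h (?v (\<lambda>b\<in>Basis. s * x b + t * y b)))"
      using mean by simp
  qed auto
  \<comment> \<open>With exponent 0 every threshold equals 1, so any positive pair serves.\<close>
  from dominates_power_meanD[OF this, of 1 1] show ?thesis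
    using f g by (simp add: eq)
qed

subsection \<open>Integration over vertical shifts\<close>

lemma inverse_antimono_ennreal:
  fixes x y :: ennreal
  assumes "x \<le> y"
  shows "inverse y \<le> inverse x"
proof (cases "x = 0 \<or> y = top")
  case False
  with assms obtain a b where "x = ennreal a" "y = ennreal b" "0 < a" "a \<le> b"
    by (cases x; cases y) (auto simp: top_unique)
  then show ?thesis
    by (simp add: inverse_ennreal le_imp_inverse_le)
qed auto

text \<open>For finite \<open>x = r\<close> the antiderivative in the shift is
  \<open>- (1 / (m * (r + a) ^ m))\<close>, which vanishes at infinity; for infinite
  \<open>x\<close> both sides are 0.\<close>

lemma inverse_power_eq_nn_integral:
  fixes x :: ennreal
  assumes "0 < x" "0 < m"
  shows "inverse x ^ m = of_nat m * (\<integral>\<^sup>+ a. inverse (x + ennreal a) ^ Suc m * indicator {0..} a \<partial>lborel)"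
proof (cases x)
  case (real r)
  with assms have r: "0 < r"
    by simp
  have "(\<integral>\<^sup>+ a. inverse (x + ennreal a) ^ Suc m * indicator {0..} a \<partial>lborel)
      = (\<integral>\<^sup>+ a. ennreal (1 / (r + a) ^ Suc m) * indicator {0..} a \<partial>lborel)"
    using r real
    by (intro nn_integral_cong)
       (auto simp: indicator_def ennreal_plus[symmetric] inverse_ennreal ennreal_power power_inverse
          inverse_eq_divide power_divide simp del: ennreal_plus power_Suc)
  also have "\<dots> = ennreal (0 - (- (1 / (real m * (r + 0) ^ m))))"
  proof (rule nn_integral_FTC_atLeast)
    fix a :: real assume "0 \<le> a"
    then have "r + a \<noteq> 0"
      using r by simp
    then have "DERIV (\<lambda>a. - (inverse (real m) * inverse ((r + a) ^ m))) a
        :> - (inverse (real m) * - (inverse ((r + a) ^ m) * (real m * (r + a) ^ (m - 1)) * inverse ((r + a) ^ m)))"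
      by (auto intro!: derivative_eq_intros)
    also have "- (inverse (real m) * - (inverse (c ^ m) * (real m * c ^ (m - 1)) * inverse (c ^ m))) = 1 / c ^ Suc m"
      if "c \<noteq> 0" for c :: real
      using that \<open>0 < m\<close> by (cases m) (simp_all add: divide_simps)
    note this[OF \<open>r + a \<noteq> 0\<close>]
    finally show "DERIV (\<lambda>a. - (1 / (real m * (r + a) ^ m))) a :> 1 / (r + a) ^ Suc m"
      by (simp add: field_simps)
  next
    have "((\<lambda>a. 1 / real m * inverse ((r + a) ^ m)) \<longlongrightarrow> 1 / real m * 0) at_top"
      using \<open>0 < m\<close>
      by (intro tendsto_mult tendsto_const tendsto_inverse_0_at_top filterlim_pow_at_top
            filterlim_tendsto_add_at_top[OF tendsto_const] filterlim_ident) auto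
    from tendsto_minus[OF this] show "((\<lambda>a. - (1 / (real m * (r + a) ^ m))) \<longlongrightarrow> 0) at_top"
      by (simp add: divide_inverse)
  qed (use r in auto)
  finally have "of_nat m * (\<integral>\<^sup>+ a. inverse (x + ennreal a) ^ Suc m * indicator {0..} a \<partial>lborel)
      = ennreal (real m) * ennreal (1 / (real m * r ^ m))"
    by (simp add: ennreal_of_nat_eq_real_of_nat)
  also have "\<dots> = ennreal (1 / r ^ m)"
    using r \<open>0 < m\<close> by (subst ennreal_mult[symmetric]) auto
  also have "\<dots> = inverse x ^ m"
    using r real by (simp add: inverse_ennreal ennreal_power power_inverse inverse_eq_divide power_divide)
  finally show ?thesis by simp
next
  case top
  with assms show ?thesis
    by (simp add: power_0_left)
qed

lemma ennreal_inverse_power_ge_iff: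
  fixes x :: ennreal
  assumes "0 < x" "0 < c" "0 < n"
  shows "ennreal (1 / c ^ n) \<le> inverse x ^ n \<longleftrightarrow> x \<le> ennreal c"
proof (cases x)
  case (real r)
  with assms have r: "0 < r"
    by simp
  have "ennreal (1 / c ^ n) \<le> inverse x ^ n \<longleftrightarrow> 1 / c ^ n \<le> 1 / r ^ n"
    using r real \<open>0 < c\<close> by (simp add: inverse_ennreal ennreal_power power_divide inverse_eq_divide)
  also have "\<dots> \<longleftrightarrow> r ^ n \<le> c ^ n"
    using r \<open>0 < c\<close> by (simp add: field_simps)
  also have "\<dots> \<longleftrightarrow> r \<le> c"
    using r assms by (simp add: power_mono_iff)
  finally show ?thesis
    using real r \<open>0 < c\<close> by simp
next
  case top
  with assms show ?thesis
    by (simp add: power_0_left top_unique not_le)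
qed

text \<open>The indicator makes this a function on the whole line that vanishes at negative shifts;
  \<open>ennreal a\<close> alone would send these to 0 and repeat the value at shift 0.\<close>

definition shifted_integral :: "('a::euclidean_space \<Rightarrow> ennreal) \<Rightarrow> real \<Rightarrow> ennreal" where
  "shifted_integral f a = (\<integral>\<^sup>+ x. inverse (f x + ennreal a) ^ DIM('a) * indicator {0..} a \<partial>lborel)"

lemma borel_measurable_shifted_integral [measurable]:
  assumes [measurable]: "f \<in> borel_measurable borel"
  shows "shifted_integral f \<in> borel_measurable borel"
  unfolding shifted_integral_def[abs_def] by measurable

lemma nn_integral_shifted_integral:
  fixes f :: "'a::euclidean_space \<Rightarrow> ennreal"
  assumes [measurable]: "f \<in> borel_measurable borel" and f: "\<And>x. 0 < f x" and n: "2 \<le> DIM('a)"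
  shows "(\<integral>\<^sup>+ x. inverse (f x) ^ (DIM('a) - 1) \<partial>lborel)
    = of_nat (DIM('a) - 1) * (\<integral>\<^sup>+ a. shifted_integral f a \<partial>lborel)"
proof -
  have n': "0 < DIM('a) - 1" "Suc (DIM('a) - 1) = DIM('a)"
    using n by auto
  have "(\<integral>\<^sup>+ x. inverse (f x) ^ (DIM('a) - 1) \<partial>lborel)
     = (\<integral>\<^sup>+ x. of_nat (DIM('a) - 1) * (\<integral>\<^sup>+ a. inverse (f x + ennreal a) ^ DIM('a) * indicator {0..} a \<partial>lborel) \<partial>lborel)"
    by (subst inverse_power_eq_nn_integral[OF f n'(1)]) (simp only: n'(2))
  also have "\<dots> = of_nat (DIM('a) - 1) * (\<integral>\<^sup>+ x. \<integral>\<^sup>+ a. inverse (f x + ennreal a) ^ DIM('a) * indicator {0..} a \<partial>lborel \<partial>lborel)"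
    by (intro nn_integral_cmult) measurable
  also have "(\<integral>\<^sup>+ x. \<integral>\<^sup>+ a. inverse (f x + ennreal a) ^ DIM('a) * indicator {0..} a \<partial>lborel \<partial>lborel)
      = (\<integral>\<^sup>+ a. \<integral>\<^sup>+ x. inverse (f x + ennreal a) ^ DIM('a) * indicator {0..} a \<partial>lborel \<partial>lborel)"
    by (intro lborel_pair.Fubini') measurable
  finally show ?thesis
    by (simp add: shifted_integral_def)
qed

text \<open>Dividing the integrands by \<open>l\<close> gives the two given functions mass at least
  1, as Borell-Brascamp-Lieb requires. The shifts add up to \<open>s * a + t * b\<close>, so the
  hypothesis on \<open>H\<close> persists after shifting.\<close>

lemma shifted_integral_superlevel:
  fixes g W H :: "'a::euclidean_space \<Rightarrow> ennreal"
  assumes st: "0 < s" "0 < t"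
    and [measurable]: "g \<in> borel_measurable borel" "W \<in> borel_measurable borel" "H \<in> borel_measurable borel"
    and pos: "\<And>x. 0 < g x" "\<And>x. 0 < W x" "\<And>x. 0 < H x"
    and H: "\<And>x y. H (s *\<^sub>R x + t *\<^sub>R y) \<le> ennreal s * g x + ennreal t * W y"
    and l: "0 < l" "ennreal l \<le> shifted_integral g a" "ennreal l \<le> shifted_integral W b"
  shows "ennreal l \<le> shifted_integral H (s * a + t * b)"
proof -
  \<comment> \<open>A positive value of \<open>shifted_integral\<close> excludes a negative
    shift.\<close>
  have ab: "0 \<le> a" "0 \<le> b"
    using l by (auto simp: shifted_integral_def intro: ccontr)
  then have sab: "0 \<le> s * a + t * b"
    using st by simp
  have shifted: "shifted_integral f c = (\<integral>\<^sup>+ x. inverse (f x + ennreal c) ^ DIM('a) \<partial>lborel)" if "0 \<le> c"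
    for f :: "'a \<Rightarrow> ennreal" and c
    using that by (simp add: shifted_integral_def)
  define v where "v = root DIM('a) l"
  have v: "0 < v" "l = v ^ DIM('a)"
    using l by (auto simp: v_def)
  have ge1: "1 \<le> (\<integral>\<^sup>+ x. ennreal (1 / l) * inverse (f x + ennreal c) ^ DIM('a) \<partial>lborel) \<longleftrightarrow> ennreal l \<le> shifted_integral f c"
    if [measurable]: "f \<in> borel_measurable borel" and "0 \<le> c" for f :: "'a \<Rightarrow> ennreal" and c
    using l(1) ennreal_le_mult_iff[of "1 / l" 1] \<open>0 \<le> c\<close> by (simp add: nn_integral_cmult shifted)
  \<comment> \<open>This turns the power mean condition into upper bounds on the shifted functions
    themselves, where the hypothesis on \<open>H\<close> is linear.\<close>
  have level: "ennreal (1 / \<alpha> ^ DIM('a)) \<le> ennreal (1 / l) * inverse X ^ DIM('a) \<longleftrightarrow> X \<le> ennreal (\<alpha> / v)"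
    if "0 < \<alpha>" "0 < X" for \<alpha> X
    using that v ennreal_inverse_power_ge_iff[of X "\<alpha> / v" "DIM('a)"] by (simp add: ennreal_le_mult_iff power_divide)
  have "1 \<le> (\<integral>\<^sup>+ x. ennreal (1 / l) * inverse (H x + ennreal (s * a + t * b)) ^ DIM('a) \<partial>lborel)"
  proof (rule borell_brascamp_lieb[OF st])
    fix x y :: 'a
    show "dominates_power_mean DIM('a) s t (ennreal (1 / l) * inverse (g x + ennreal a) ^ DIM('a))
      (ennreal (1 / l) * inverse (W y + ennreal b) ^ DIM('a))
      (ennreal (1 / l) * inverse (H (s *\<^sub>R x + t *\<^sub>R y) + ennreal (s * a + t * b)) ^ DIM('a))"
    proof (rule dominates_power_meanI)
      fix \<alpha> \<beta> :: real
      assume \<alpha>\<beta>: "0 < \<alpha>" "0 < \<beta>"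
        and "ennreal (1 / \<alpha> ^ DIM('a)) \<le> ennreal (1 / l) * inverse (g x + ennreal a) ^ DIM('a)"
          "ennreal (1 / \<beta> ^ DIM('a)) \<le> ennreal (1 / l) * inverse (W y + ennreal b) ^ DIM('a)"
      then have *: "g x + ennreal a \<le> ennreal (\<alpha> / v)" "W y + ennreal b \<le> ennreal (\<beta> / v)"
        using pos by (simp_all add: level add_pos_nonneg)
      have "H (s *\<^sub>R x + t *\<^sub>R y) + ennreal (s * a + t * b)
          \<le> (ennreal s * g x + ennreal t * W y) + (ennreal s * ennreal a + ennreal t * ennreal b)"
        using st ab H by (intro add_mono) (auto simp: ennreal_mult)
      also have "\<dots> = ennreal s * (g x + ennreal a) + ennreal t * (W y + ennreal b)"
        by (simp add: distrib_left ac_simps)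
      also have "\<dots> \<le> ennreal s * ennreal (\<alpha> / v) + ennreal t * ennreal (\<beta> / v)"
        using * by (intro add_mono mult_left_mono) auto
      also have "\<dots> = ennreal ((s * \<alpha> + t * \<beta>) / v)"
        using st \<alpha>\<beta> v by (simp add: ennreal_mult[symmetric] ennreal_plus[symmetric] add_divide_distrib del: ennreal_plus)
      finally show "ennreal (1 / (s * \<alpha> + t * \<beta>) ^ DIM('a))
          \<le> ennreal (1 / l) * inverse (H (s *\<^sub>R x + t *\<^sub>R y) + ennreal (s * a + t * b)) ^ DIM('a)"
        using st \<alpha>\<beta> pos by (subst level) (auto intro: add_pos_pos add_pos_nonneg)
    qed
  qed (use l ab ge1 in auto)
  with ge1 sab show ?thesis
    by simp
qed

section \<open>Assembly for interior parameters and treatment of the endpoints\<close>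

lemma dynamical_borell_brascamp_lieb:
  fixes g W H :: "'a::euclidean_space \<Rightarrow> ennreal"
  assumes n: "2 \<le> DIM('a)" and st: "0 < s" "0 < t"
    and [measurable]: "g \<in> borel_measurable borel" "W \<in> borel_measurable borel" "H \<in> borel_measurable borel"
    and pos: "\<And>x. 0 < g x" "\<And>x. 0 < W x" "\<And>x. 0 < H x"
    and H: "\<And>x y. H (s *\<^sub>R x + t *\<^sub>R y) \<le> ennreal s * g x + ennreal t * W y"
    and g1: "(\<integral>\<^sup>+ x. inverse (g x) ^ DIM('a) \<partial>lborel) = 1"
    and W1: "(\<integral>\<^sup>+ x. inverse (W x) ^ DIM('a) \<partial>lborel) = 1"
  shows "ennreal s * (\<integral>\<^sup>+ x. inverse (g x) ^ (DIM('a) - 1) \<partial>lborel)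
      + ennreal t * (\<integral>\<^sup>+ x. inverse (W x) ^ (DIM('a) - 1) \<partial>lborel)
    \<le> (\<integral>\<^sup>+ x. inverse (H x) ^ (DIM('a) - 1) \<partial>lborel)"
proof -
  \<comment> \<open>Shifting upward only decreases the inverse powers, so the total mass stays at
    most 1 and truncation at 1 changes nothing.\<close>
  have le1: "min (shifted_integral f a) 1 = shifted_integral f a"
    if "(\<integral>\<^sup>+ x. inverse (f x) ^ DIM('a) \<partial>lborel) = 1" for f :: "'a \<Rightarrow> ennreal" and a
  proof -
    have "shifted_integral f a \<le> (\<integral>\<^sup>+ x. inverse (f x) ^ DIM('a) \<partial>lborel)"
      unfolding shifted_integral_def
      by (intro nn_integral_mono) (auto simp: indicator_def intro!: power_mono inverse_antimono_ennreal)
    with that show ?thesis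
      by (simp add: min_absorb1)
  qed
  have "ennreal s * (\<integral>\<^sup>+ a. min (shifted_integral g a) 1 \<partial>lborel)
      + ennreal t * (\<integral>\<^sup>+ a. min (shifted_integral W a) 1 \<partial>lborel) \<le> (\<integral>\<^sup>+ a. shifted_integral H a \<partial>lborel)"
  proof (rule nn_integral_ge_of_level_sets)
    \<comment> \<open>Both normalised masses attain the common height 1 at shift 0.\<close>
    show "1 \<le> shifted_integral g 0" "1 \<le> shifted_integral W 0"
      by (simp_all add: shifted_integral_def g1 W1)
  next
    fix l a b :: real
    assume "0 < l" "ennreal l \<le> shifted_integral g a" "ennreal l \<le> shifted_integral W b"
    then show "ennreal l \<le> shifted_integral H (s * a + t * b)"
      by (rule shifted_integral_superlevel[where g = g and W = W and H = H, OF st, rotated 7])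
         (use pos H in simp_all)
  qed (use st in simp_all)
  then have "of_nat (DIM('a) - 1) * (ennreal s * (\<integral>\<^sup>+ a. shifted_integral g a \<partial>lborel)
      + ennreal t * (\<integral>\<^sup>+ a. shifted_integral W a \<partial>lborel)) \<le> of_nat (DIM('a) - 1) * (\<integral>\<^sup>+ a. shifted_integral H a \<partial>lborel)"
    unfolding le1[OF g1] le1[OF W1] by (rule mult_left_mono) simp
  then show ?thesis
    unfolding nn_integral_shifted_integral[OF assms(4) pos(1) n]
      nn_integral_shifted_integral[OF assms(5) pos(2) n] nn_integral_shifted_integral[OF assms(6) pos(3) n]
    by (simp add: distrib_left mult.left_commute)
qed

theorem theorem2:
  fixes g W H :: "real ^ 'n \<Rightarrow> ennreal"
    and s t :: real
  assumes n_ge_2: "CARD('n) \<ge> 2"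
    and g_borel: "g \<in> borel_measurable borel"
    and W_borel: "W \<in> borel_measurable borel"
    and H_borel: "H \<in> borel_measurable borel"
    and g_pos: "\<And>x. 0 < g x"
    and W_pos: "\<And>x. 0 < W x"
    and H_pos: "\<And>x. 0 < H x"
    and s_range: "s \<in> {0..1}"
    and t_eq: "t = 1 - s"
    and H_le: "\<And>x y. H (s *\<^sub>R x + t *\<^sub>R y) \<le> ennreal s * g x + ennreal t * W y"
    and W_int: "(\<integral>\<^sup>+ x. W x powi (- int CARD('n)) \<partial>lborel) = 1"
    and g_int: "(\<integral>\<^sup>+ x. g x powi (- int CARD('n)) \<partial>lborel) = 1"
  shows "(\<integral>\<^sup>+ x. H x powi (1 - int CARD('n)) \<partial>lborel)
    \<ge> ennreal s * (\<integral>\<^sup>+ x. g x powi (1 - int CARD('n)) \<partial>lborel)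
      + ennreal t * (\<integral>\<^sup>+ x. W x powi (1 - int CARD('n)) \<partial>lborel)"
proof -
  have powi1: "u powi (1 - int CARD('n)) = inverse u ^ (CARD('n) - 1)" for u :: ennreal
    using n_ge_2 by (simp add: power_int_def nat_diff_distrib)
  have powi: "u powi (- int CARD('n)) = inverse u ^ CARD('n)" for u :: ennreal
    by (simp add: power_int_def)
  \<comment> \<open>At an endpoint \<open>0 * \<infinity> = 0\<close> reduces the hypothesis to a
    pointwise bound of \<open>H\<close> by \<open>W\<close> or by \<open>g\<close>, and monotonicity
    suffices.\<close>
  consider "s = 0" "t = 1" | "s = 1" "t = 0" | "0 < s" "0 < t"
    using s_range t_eq by fastforce
  then show ?thesis
  proof cases
    case 1
    then have "H y \<le> W y" for y
      using H_le[of 0 y] by simp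
    with 1 show ?thesis
      by (auto simp: powi1 intro!: nn_integral_mono power_mono inverse_antimono_ennreal)
  next
    case 2
    then have "H x \<le> g x" for x
      using H_le[of x 0] by simp
    with 2 show ?thesis
      by (auto simp: powi1 intro!: nn_integral_mono power_mono inverse_antimono_ennreal)
  next
    case 3
    then show ?thesis
      using dynamical_borell_brascamp_lieb[OF _ 3 g_borel W_borel H_borel g_pos W_pos H_pos H_le] n_ge_2 g_int W_int
      by (simp add: powi powi1)
  qed
qed

end
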